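(* Let $G$ be a graph with no isolated vertex and let $H$ be a nontrivial graph. Then the following statements are equivalent. (a) $\gamma_{\times 2}(G\circ H)=2\gamma_t(G)$. (b) $\gamma_{\times 2}(G\circ H)=\gamma_{tR}(G\circ H)$ and ($\gamma_t(G)=\gamma(G)$ or $\gamma(H)\geq 2$).
   Context: All graphs are finite, undirected, without loops or multiple edges, and have at least one vertex; a graph is nontrivial if it has at least two vertices. $N(v)$ denotes the open neighbourhood of $v$ (the set of vertices adjacent to $v$). The lexicographic product $G\circ H$ has vertex set $V(G)\times V(H)$, and $(u,v)$ is adjacent to $(x,y)$ if and only if $ux\in E(G)$, or $u=x$ and $vy\in E(H)$. A vertex dominates itself and its neighbours. The domination number $\gamma(F)$ of a graph $F$ is the minimum cardinality of a set $S\subseteq V(F)$ such that every vertex of $F$ is dominated by at least one vertex of $S$. For a graph $F$ with no isolated vertex: $\gamma_{\times 2}(F)$ is the minimum cardinality of a double dominating set, i.e. a set $S\subseteq V(F)$ such that every vertex of $F$ is dominated by at least two vertices of $S$; $\gamma_t(F)$ is the minimum cardinality of a total dominating set, i.e. a set $S\subseteq V(F)$ such that every vertex of $F$ (including those in $S$) has a neighbour in $S$; $\gamma_{tR}(F)$ is the minimum of $\sum_{v\in V(F)}f(v)$ over all total Roman dominating functions, i.e. functions $f:V(F)\to\{0,1,2\}$ such that $\{v:f(v)\ge 1\}$ is a total dominating set of $F$ and every vertex $v$ with $f(v)=0$ has a neighbour $w\in N(v)$ with $f(w)=2$. *)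

theory Defs
  imports "Graph_Theory.Pair_Digraph"
begin

(* A finite simple undirected graph is a pair_graph of the AFP entry Graph_Theory: a finite,
   loop-free set of vertex pairs that is symmetric, so that the edge uv is represented by the
   two arcs (u, v) and (v, u). That locale allows the graph without vertices, which has to be
   excluded separately. *)

definition neighbourhood :: "'a pair_pre_digraph \<Rightarrow> 'a \<Rightarrow> 'a set" where
  "neighbourhood G v = {w. (v, w) \<in> parcs G}"

definition no_isolated_vertex :: "'a pair_pre_digraph \<Rightarrow> bool" where
  "no_isolated_vertex G \<longleftrightarrow> (\<forall>v\<in>pverts G. neighbourhood G v \<noteq> {})"

definition lexicographic_product ::
    "'a pair_pre_digraph \<Rightarrow> 'b pair_pre_digraph \<Rightarrow> ('a \<times> 'b) pair_pre_digraph" where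
  "lexicographic_product G H =
     \<lparr> pverts = pverts G \<times> pverts H,
       parcs = {((u, v), (x, y)).
                  (u, v) \<in> pverts G \<times> pverts H \<and> (x, y) \<in> pverts G \<times> pverts H \<and>
                  ((u, x) \<in> parcs G \<or> u = x \<and> (v, y) \<in> parcs H)} \<rparr>"

(* Unlike the adjacency abbreviation "dominates" of Graph_Theory, a vertex dominates itself. *)
definition vertex_dominates :: "'a pair_pre_digraph \<Rightarrow> 'a \<Rightarrow> 'a \<Rightarrow> bool" where
  "vertex_dominates G u v \<longleftrightarrow> v = u \<or> v \<in> neighbourhood G u"

definition dominating_set :: "'a pair_pre_digraph \<Rightarrow> 'a set \<Rightarrow> bool" where
  "dominating_set G S \<longleftrightarrow>
     S \<subseteq> pverts G \<and> (\<forall>v\<in>pverts G. \<exists>u\<in>S. vertex_dominates G u v)"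

definition double_dominating_set :: "'a pair_pre_digraph \<Rightarrow> 'a set \<Rightarrow> bool" where
  "double_dominating_set G S \<longleftrightarrow>
     S \<subseteq> pverts G \<and> (\<forall>v\<in>pverts G. card {u\<in>S. vertex_dominates G u v} \<ge> 2)"

definition total_dominating_set :: "'a pair_pre_digraph \<Rightarrow> 'a set \<Rightarrow> bool" where
  "total_dominating_set G S \<longleftrightarrow>
     S \<subseteq> pverts G \<and> (\<forall>v\<in>pverts G. \<exists>u\<in>S. u \<in> neighbourhood G v)"

(* Functions on the vertex set are represented by functions on the whole type; their values
   outside the vertex set are never used. *)
definition total_Roman_dominating_function ::
    "'a pair_pre_digraph \<Rightarrow> ('a \<Rightarrow> nat) \<Rightarrow> bool" where
  "total_Roman_dominating_function G f \<longleftrightarrow>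
     (\<forall>v\<in>pverts G. f v \<in> {0, 1, 2}) \<and>
     total_dominating_set G {v\<in>pverts G. f v \<ge> 1} \<and>
     (\<forall>v\<in>pverts G. f v = 0 \<longrightarrow> (\<exists>w\<in>neighbourhood G v. f w = 2))"

(* The least values below exist by the lemmas at the end of this theory, for the last three
   numbers only if the graph has no isolated vertex. *)

definition domination_number :: "'a pair_pre_digraph \<Rightarrow> nat" where
  "domination_number G = (LEAST k. \<exists>S. dominating_set G S \<and> k = card S)"

definition double_domination_number :: "'a pair_pre_digraph \<Rightarrow> nat" where
  "double_domination_number G = (LEAST k. \<exists>S. double_dominating_set G S \<and> k = card S)"

definition total_domination_number :: "'a pair_pre_digraph \<Rightarrow> nat" where
  "total_domination_number G = (LEAST k. \<exists>S. total_dominating_set G S \<and> k = card S)"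

definition total_Roman_domination_number :: "'a pair_pre_digraph \<Rightarrow> nat" where
  "total_Roman_domination_number G =
     (LEAST k. \<exists>f. total_Roman_dominating_function G f \<and> k = (\<Sum>v\<in>pverts G. f v))"

lemma pair_graph_lexicographic_product:
  assumes "pair_graph G" and "pair_graph H"
  shows "pair_graph (lexicographic_product G H)"
proof -
  interpret G: pair_graph G by fact
  interpret H: pair_graph H by fact
  let ?P = "lexicographic_product G H"
  have fin: "finite (pverts ?P)"
    by (simp add: lexicographic_product_def G.pair_finite_verts H.pair_finite_verts)
  have sub: "parcs ?P \<subseteq> pverts ?P \<times> pverts ?P"
    by (auto simp: lexicographic_product_def)
  have "sym (parcs G)" "sym (parcs H)"
    using G.pair_sym_arcs H.pair_sym_arcs by (simp_all add: symmetric_def)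
  then have sym: "sym (parcs ?P)"
    by (auto simp: lexicographic_product_def sym_def)
  show ?thesis
  proof
    show "finite (pverts ?P)" by (rule fin)
    show "finite (parcs ?P)" using sub fin by (blast intro: finite_subset)
    show "symmetric (with_proj ?P)" using sym by (simp add: symmetric_def)
    show "fst e \<in> pverts ?P" "snd e \<in> pverts ?P" if "e \<in> parcs ?P" for e
      using sub that by auto
    show "fst e \<noteq> snd e" if "e \<in> parcs ?P" for e
      using that G.pair_no_loops H.pair_no_loops
      by (fastforce simp: lexicographic_product_def)
  qed
qed

lemma no_isolated_vertex_lexicographic_product:
  assumes "pair_graph G" and "no_isolated_vertex G"
  shows "no_isolated_vertex (lexicographic_product G H)"
proof -
  interpret G: pair_graph G by fact
  show ?thesis
    using assms(2) G.in_arcsD2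
    unfolding no_isolated_vertex_def neighbourhood_def lexicographic_product_def
    by fastforce
qed

lemma dominating_set_pverts: "dominating_set G (pverts G)"
  by (auto simp: dominating_set_def vertex_dominates_def)

lemma double_dominating_set_pverts:
  assumes "pair_graph G" and "no_isolated_vertex G"
  shows "double_dominating_set G (pverts G)"
  unfolding double_dominating_set_def
proof (intro conjI ballI subset_refl)
  interpret G: pair_graph G by fact
  fix v assume v: "v \<in> pverts G"
  then obtain w where w: "(v, w) \<in> parcs G"
    using assms(2) by (auto simp: no_isolated_vertex_def neighbourhood_def)
  have "sym (parcs G)"
    using G.pair_sym_arcs by (simp add: symmetric_def)
  with w have wv: "(w, v) \<in> parcs G"
    by (rule symD[rotated])
  have "card {v, w} \<le> card {u\<in>pverts G. vertex_dominates G u v}"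
    using v wv G.in_arcsD1[OF wv]
    by (intro card_mono) (auto simp: vertex_dominates_def neighbourhood_def G.pair_finite_verts)
  moreover have "v \<noteq> w"
    using G.pair_no_loops[OF w] by simp
  ultimately show "card {u\<in>pverts G. vertex_dominates G u v} \<ge> 2"
    by simp
qed

lemma total_dominating_set_pverts:
  assumes "pair_graph G" and "no_isolated_vertex G"
  shows "total_dominating_set G (pverts G)"
proof -
  interpret G: pair_graph G by fact
  show ?thesis
    using assms(2) G.in_arcsD2
    by (fastforce simp: total_dominating_set_def no_isolated_vertex_def neighbourhood_def)
qed

lemma total_Roman_dominating_function_one:
  assumes "pair_graph G" and "no_isolated_vertex G"
  shows "total_Roman_dominating_function G (\<lambda>_. 1)"
  using total_dominating_set_pverts[OF assms]
  by (simp add: total_Roman_dominating_function_def)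

end

theory Submission
  imports Defs
begin

text \<open>
  Write \<open>P\<close> for \<open>G \<circ> H\<close>. Placing weight 2 on one copy of a total dominating set of \<open>G\<close> gives
  \<open>\<gamma>\<^sub>t\<^sub>R(P) \<le> 2\<gamma>\<^sub>t(G)\<close>. Conversely \<open>\<gamma>\<^sub>t\<^sub>R(P) \<ge> 2\<gamma>(P) \<ge> 2\<gamma>(G)\<close>, by Ore's argument applied to the
  vertices of weight 1, and if \<open>\<gamma>(H) \<ge> 2\<close> then even \<open>\<gamma>\<^sub>t\<^sub>R(P) \<ge> 2\<gamma>\<^sub>t(G)\<close>, by discharging the weights
  of the \<open>H\<close>-fibres. So either alternative in (b) forces \<open>\<gamma>\<^sub>t\<^sub>R(P) = 2\<gamma>\<^sub>t(G)\<close>, and it remains to see that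
  (a) implies one of them. If \<open>\<gamma>(H) = 1\<close>, take one copy of a minimum total dominating set of \<open>G\<close> and one
  copy of a minimum dominating set of \<open>G\<close>, the latter at a universal vertex of \<open>H\<close>: this shows
  \<open>\<gamma>\<^bsub>\<times>2\<^esub>(P) \<le> \<gamma>\<^sub>t(G) + \<gamma>(G)\<close>, so (a) gives \<open>\<gamma>\<^sub>t(G) = \<gamma>(G)\<close>.
\<close>

section \<open>Bounds from witnesses, and minimisers\<close>

lemma domination_number_le: "dominating_set G S \<Longrightarrow> domination_number G \<le> card S"
  unfolding domination_number_def by (rule Least_le) blast

lemma double_domination_number_le:
  "double_dominating_set G S \<Longrightarrow> double_domination_number G \<le> card S"
  unfolding double_domination_number_def by (rule Least_le) blast

lemma total_domination_number_le:
  "total_dominating_set G S \<Longrightarrow> total_domination_number G \<le> card S"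
  unfolding total_domination_number_def by (rule Least_le) blast

lemma total_Roman_domination_number_le:
  "total_Roman_dominating_function G f \<Longrightarrow> total_Roman_domination_number G \<le> (\<Sum>v\<in>pverts G. f v)"
  unfolding total_Roman_domination_number_def by (rule Least_le) blast

lemma minimum_dominating_set:
  obtains S where "dominating_set G S" "card S = domination_number G"
proof -
  have "\<exists>S. dominating_set G S \<and> domination_number G = card S"
    unfolding domination_number_def
    by (rule LeastI_ex[of "\<lambda>k. \<exists>S. dominating_set G S \<and> k = card S"])
      (use dominating_set_pverts in blast)
  then show thesis using that by auto
qed

lemma minimum_total_dominating_set:
  assumes "pair_graph G" "no_isolated_vertex G"
  obtains S where "total_dominating_set G S" "card S = total_domination_number G"
proof -
  have "\<exists>S. total_dominating_set G S \<and> total_domination_number G = card S"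
    unfolding total_domination_number_def
    by (rule LeastI_ex[of "\<lambda>k. \<exists>S. total_dominating_set G S \<and> k = card S"])
      (use total_dominating_set_pverts[OF assms] in blast)
  then show thesis using that by auto
qed

lemma minimum_total_Roman_dominating_function:
  assumes "pair_graph G" "no_isolated_vertex G"
  obtains f where "total_Roman_dominating_function G f"
    "(\<Sum>v\<in>pverts G. f v) = total_Roman_domination_number G"
proof -
  have "\<exists>f. total_Roman_dominating_function G f
      \<and> total_Roman_domination_number G = (\<Sum>v\<in>pverts G. f v)"
    unfolding total_Roman_domination_number_def
    by (rule LeastI_ex[of "\<lambda>k. \<exists>f. total_Roman_dominating_function G f \<and> k = (\<Sum>v\<in>pverts G. f v)"])
      (use total_Roman_dominating_function_one[OF assms] in blast)
  then show thesis using that by auto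
qed

section \<open>Neighbourhoods in graphs and in lexicographic products\<close>

lemma finite_pverts:
  assumes "pair_graph G"
  shows "finite (pverts G)"
proof -
  interpret pair_graph G by fact
  show ?thesis by (rule pair_finite_verts)
qed

lemma neighbourhood_sym:
  assumes "pair_graph G" "w \<in> neighbourhood G v"
  shows "v \<in> neighbourhood G w"
proof -
  interpret pair_graph G by fact
  have "sym (parcs G)" using pair_sym_arcs by (simp add: symmetric_def)
  then show ?thesis using assms(2) by (auto simp: neighbourhood_def sym_def)
qed

lemma neighbourhood_irrefl:
  assumes "pair_graph G"
  shows "v \<notin> neighbourhood G v"
proof -
  interpret pair_graph G by fact
  show ?thesis using pair_no_loops by (fastforce simp: neighbourhood_def)
qed

lemma neighbourhood_subset_pverts:
  assumes "pair_graph G"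
  shows "neighbourhood G v \<subseteq> pverts G"
proof -
  interpret pair_graph G by fact
  show ?thesis using in_arcsD2 by (fastforce simp: neighbourhood_def)
qed

lemma pverts_lexicographic_product [simp]:
  "pverts (lexicographic_product G H) = pverts G \<times> pverts H"
  by (simp add: lexicographic_product_def)

lemma mem_neighbourhood_lexicographic_product:
  assumes "x \<in> pverts G" "y \<in> pverts H"
  shows "(u, v) \<in> neighbourhood (lexicographic_product G H) (x, y) \<longleftrightarrow>
    u \<in> pverts G \<and> v \<in> pverts H \<and>
    (u \<in> neighbourhood G x \<or> u = x \<and> v \<in> neighbourhood H y)"
  using assms by (auto simp: neighbourhood_def lexicographic_product_def)

section \<open>Comparisons between \<open>G\<close> and the product\<close>

lemma domination_number_le_total_domination_number:
  assumes "pair_graph G" "no_isolated_vertex G"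
  shows "domination_number G \<le> total_domination_number G"
proof -
  obtain S where S: "total_dominating_set G S" "card S = total_domination_number G"
    using minimum_total_dominating_set[OF assms] .
  then have "dominating_set G S"
    using neighbourhood_sym[OF assms(1)]
    unfolding dominating_set_def total_dominating_set_def vertex_dominates_def by blast
  then show ?thesis using domination_number_le S(2) by metis
qed

text \<open>Adjacent vertices of the product have equal or adjacent first coordinates, so the
  projection of a dominating set dominates \<open>G\<close>; testing on a single copy of
  \<open>G\<close> suffices.\<close>

lemma domination_number_le_lexicographic_product:
  assumes "pair_graph G" "pair_graph H" "pverts H \<noteq> {}"
  shows "domination_number G \<le> domination_number (lexicographic_product G H)"
proof -
  let ?P = "lexicographic_product G H"
  obtain S where S: "dominating_set ?P S" "card S = domination_number ?P"
    using minimum_dominating_set .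
  have sub: "S \<subseteq> pverts G \<times> pverts H"
    using S(1) by (simp add: dominating_set_def)
  have "finite (pverts G \<times> pverts H)"
    using assms by (simp add: finite_pverts)
  then have fin: "finite S" using sub by (rule finite_subset[rotated])
  obtain h where h: "h \<in> pverts H" using assms(3) by blast
  have "dominating_set G (fst ` S)"
    unfolding dominating_set_def
  proof (intro conjI ballI)
    show "fst ` S \<subseteq> pverts G" using sub by auto
    fix x assume x: "x \<in> pverts G"
    then obtain u v where uv: "(u, v) \<in> S" "vertex_dominates ?P (u, v) (x, h)"
      using S(1) h unfolding dominating_set_def by fastforce
    then have "vertex_dominates G u x"
      using sub mem_neighbourhood_lexicographic_product[of u G v H x h]
      by (auto simp: vertex_dominates_def)
    then show "\<exists>u\<in>fst ` S. vertex_dominates G u x" using uv(1) by force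
  qed
  then have "domination_number G \<le> card (fst ` S)" by (rule domination_number_le)
  also have "\<dots> \<le> card S" using fin by (rule card_image_le)
  finally show ?thesis using S(2) by simp
qed

text \<open>If \<open>u\<close> is a neighbour of \<open>x\<close>, then \<open>(u, h)\<close> is
  adjacent to the whole fibre over \<open>x\<close>. Hence every vertex, also one of positive
  weight, has a neighbour of weight 2, which settles both the total and the Roman condition.\<close>

lemma total_Roman_domination_number_lexicographic_product_le:
  assumes "pair_graph G" "no_isolated_vertex G" "pair_graph H" "pverts H \<noteq> {}"
  shows "total_Roman_domination_number (lexicographic_product G H) \<le> 2 * total_domination_number G"
proof -
  let ?P = "lexicographic_product G H"
  obtain D where D: "total_dominating_set G D" "card D = total_domination_number G"
    using minimum_total_dominating_set[OF assms(1,2)] .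
  have sub: "D \<subseteq> pverts G" using D(1) by (simp add: total_dominating_set_def)
  have fin: "finite (pverts G)" "finite (pverts H)"
    using assms by (simp_all add: finite_pverts)
  obtain h where h: "h \<in> pverts H" using assms(4) by blast
  define f :: "'a \<times> 'b \<Rightarrow> nat" where "f = (\<lambda>v. 2 * of_bool (v \<in> D \<times> {h}))"
  have nb: "\<exists>w\<in>neighbourhood ?P v. w \<in> pverts ?P \<and> f w = 2" if v: "v \<in> pverts ?P" for v
  proof -
    obtain x y where xy: "v = (x, y)" "x \<in> pverts G" "y \<in> pverts H" using v by auto
    obtain u where u: "u \<in> D" "u \<in> neighbourhood G x"
      using D(1) xy(2) by (auto simp: total_dominating_set_def)
    have "(u, h) \<in> neighbourhood ?P v"
      using xy u sub h by (auto simp: mem_neighbourhood_lexicographic_product)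
    moreover have "f (u, h) = 2" using u by (simp add: f_def)
    moreover have "(u, h) \<in> pverts ?P" using u sub h by auto
    ultimately show ?thesis by blast
  qed
  have "total_Roman_dominating_function ?P f"
    unfolding total_Roman_dominating_function_def total_dominating_set_def
  proof (intro conjI ballI impI)
    show "f v \<in> {0, 1, 2}" for v by (simp add: f_def)
    show "{v \<in> pverts ?P. 1 \<le> f v} \<subseteq> pverts ?P" by blast
    fix v assume "v \<in> pverts ?P"
    from nb[OF this] obtain w where w: "w \<in> neighbourhood ?P v" "w \<in> pverts ?P" "f w = 2"
      by blast
    then show "\<exists>u\<in>{v \<in> pverts ?P. 1 \<le> f v}. u \<in> neighbourhood ?P v"
      by (intro bexI[of _ w]) auto
    show "\<exists>w\<in>neighbourhood ?P v. f w = 2" using w by blast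
  qed
  then have "total_Roman_domination_number ?P \<le> (\<Sum>v\<in>pverts ?P. f v)"
    by (rule total_Roman_domination_number_le)
  also have "\<dots> = 2 * card ((pverts G \<times> pverts H) \<inter> (D \<times> {h}))"
    using fin by (simp add: f_def sum_distrib_left[symmetric] del: mem_Sigma_iff)
  also have "(pverts G \<times> pverts H) \<inter> (D \<times> {h}) = D \<times> {h}" using sub h by auto
  also have "card (D \<times> {h}) = card D" by (simp add: card_cartesian_product)
  finally show ?thesis using D(2) by simp
qed

text \<open>The two copies lie at different vertices \<open>h\<close> and \<open>k\<close> of
  \<open>H\<close>, so the two dominators found are distinct even over the same vertex of
  \<open>G\<close>. Universality of \<open>k\<close> matters when \<open>x\<close> is dominated only
  by itself: \<open>(x, k)\<close> still dominates its whole fibre.\<close>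

lemma double_domination_number_lexicographic_product_le:
  assumes "pair_graph G" "no_isolated_vertex G" "pair_graph H" "card (pverts H) \<ge> 2"
    and "domination_number H < 2"
  shows "double_domination_number (lexicographic_product G H)
    \<le> total_domination_number G + domination_number G"
proof -
  let ?P = "lexicographic_product G H"
  obtain D where D: "total_dominating_set G D" "card D = total_domination_number G"
    using minimum_total_dominating_set[OF assms(1,2)] .
  obtain S where S: "dominating_set G S" "card S = domination_number G"
    using minimum_dominating_set .
  obtain K where K: "dominating_set H K" "card K = domination_number H"
    using minimum_dominating_set .
  have fin: "finite (pverts G)" "finite (pverts H)"
    using assms by (simp_all add: finite_pverts)
  have sub: "D \<subseteq> pverts G" "S \<subseteq> pverts G" "K \<subseteq> pverts H"
    using D(1) S(1) K(1)
    by (simp_all add: total_dominating_set_def dominating_set_def)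
  then have finDSK: "finite D" "finite S" "finite K" using fin by (auto intro: finite_subset)
  \<comment> \<open>The bound on the domination number leaves 0 or 1; nonemptiness excludes
    0.\<close>
  have "pverts H \<noteq> {}" using assms(4) by auto
  then have "K \<noteq> {}" using K(1) by (auto simp: dominating_set_def)
  then have "0 < card K" using finDSK(3) by (simp add: card_gt_0_iff)
  then have "card K = 1" using K(2) assms(5) by linarith
  then obtain k where k: "K = {k}" by (auto simp: card_1_singleton_iff)
  have univ: "vertex_dominates H k y" if "y \<in> pverts H" for y
    using K(1) k that by (auto simp: dominating_set_def)
  have kH: "k \<in> pverts H" using k sub by simp
  obtain h where h: "h \<in> pverts H" "h \<noteq> k"
  proof -
    have "\<not> pverts H \<subseteq> {k}" using assms(4) card_mono[of "{k}" "pverts H"] by auto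
    then show thesis using that by auto
  qed
  let ?T = "D \<times> {h} \<union> S \<times> {k}"
  have finT: "finite ?T" using finDSK by simp
  have "double_dominating_set ?P ?T"
    unfolding double_dominating_set_def
  proof (intro conjI ballI)
    show "?T \<subseteq> pverts ?P" using sub h kH by auto
    fix v assume "v \<in> pverts ?P"
    then obtain x y where xy: "v = (x, y)" "x \<in> pverts G" "y \<in> pverts H" by auto
    obtain d where d: "d \<in> D" "d \<in> neighbourhood G x"
      using D(1) xy(2) by (auto simp: total_dominating_set_def)
    have "x \<in> neighbourhood G d" using neighbourhood_sym[OF assms(1)] d by blast
    then have vd: "vertex_dominates ?P (d, h) v"
      using xy d(1) sub h by (auto simp: vertex_dominates_def mem_neighbourhood_lexicographic_product)
    obtain s where s: "s \<in> S" "vertex_dominates G s x"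
      using S(1) xy(2) by (auto simp: dominating_set_def)
    then have vs: "vertex_dominates ?P (s, k) v"
      using xy sub kH univ[OF xy(3)]
      by (auto simp: vertex_dominates_def mem_neighbourhood_lexicographic_product)
    have "card {(d, h), (s, k)} \<le> card {u \<in> ?T. vertex_dominates ?P u v}"
      using finT vd vs d(1) s(1) by (intro card_mono) auto
    then show "2 \<le> card {u \<in> ?T. vertex_dominates ?P u v}" using h(2) by simp
  qed
  then have "double_domination_number ?P \<le> card ?T" by (rule double_domination_number_le)
  also have "\<dots> \<le> card (D \<times> {h}) + card (S \<times> {k})" by (rule card_Un_le)
  also have "\<dots> = card D + card S" by (simp add: card_cartesian_product)
  finally show ?thesis using D(2) S(2) by simp
qed

section \<open>Ore's argument and the lower bound by domination\<close>

text \<open>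
  Ore's argument: the complement of a minimal dominating subset still dominates, so the smaller of the
  two has at most half of the elements.
\<close>
lemma half_size_dominating_subset:
  fixes R :: "'a \<Rightarrow> 'a \<Rightarrow> bool"
  assumes "finite A" "W \<subseteq> A" and sym: "\<And>u v. R u v \<Longrightarrow> R v u"
    and nb: "\<And>w. w \<in> W \<Longrightarrow> \<exists>u\<in>A. u \<noteq> w \<and> R u w"
  obtains X where "X \<subseteq> A" "2 * card X \<le> card A" "\<And>w. w \<in> W \<Longrightarrow> \<exists>u\<in>X. u = w \<or> R u w"
proof -
  let ?dom = "\<lambda>X. X \<subseteq> A \<and> (\<forall>w\<in>W. \<exists>u\<in>X. u = w \<or> R u w)"
  have "?dom A" using assms(2) by blast
  \<comment> \<open>Least cardinality, not just minimality under inclusion, so that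
    \<open>min\<close> also gives the comparison with \<open>A - X\<close> below.\<close>
  then obtain X where X: "?dom X" and min: "\<And>Y. ?dom Y \<Longrightarrow> card X \<le> card Y"
    using ex_has_least_nat[of ?dom A card] by blast
  have finX: "finite X" using X assms(1) by (auto intro: finite_subset)
  have "?dom (A - X)"
  proof (intro conjI ballI)
    fix w assume w: "w \<in> W"
    show "\<exists>u\<in>A - X. u = w \<or> R u w"
    proof (rule ccontr)
      assume neg: "\<not> ?thesis"
      then have wX: "w \<in> X" using w assms(2) by blast
      obtain u where u: "u \<in> A" "u \<noteq> w" "R u w" using nb[OF w] by blast
      then have uX: "u \<in> X" using neg by blast
      \<comment> \<open>\<open>w\<close> remains dominated by \<open>u\<close>, and any
        \<open>w'\<close> that relied on \<open>w\<close> is a neighbour of \<open>w\<close>, hence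
        by \<open>neg\<close> in \<open>X\<close>, where it dominates itself.\<close>
      have "?dom (X - {w})"
      proof (intro conjI ballI)
        fix w' assume w': "w' \<in> W"
        show "\<exists>u\<in>X - {w}. u = w' \<or> R u w'"
        proof (cases "w' = w")
          case True
          then show ?thesis using u uX by blast
        next
          case False
          obtain t where t: "t \<in> X" "t = w' \<or> R t w'" using X w' by blast
          show ?thesis
          proof (cases "t = w")
            case True
            then have "R w' w" using t False sym by blast
            then have "w' \<in> X" using neg w' assms(2) by blast
            then show ?thesis using False by blast
          qed (use t in blast)
        qed
      qed (use X in blast)
      then show False using min[of "X - {w}"] card_Diff1_less[OF finX wX] by simp
    qed
  qed simp
  moreover have "card X + card (A - X) = card A"
    using X assms(1) finX by (simp add: card_Diff_subset card_mono)
  moreover have "card X \<le> card (A - X)" using min calculation(1) by blast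
  ultimately show thesis using X that[of X] by simp
qed

text \<open>All of \<open>B\<close> is kept, but only half of \<open>A\<close>. Vertices of weight 0
  are dominated by \<open>B\<close>, so Ore's argument only has to serve \<open>W\<close>; a
  positive neighbour of a vertex in \<open>W\<close> cannot lie in \<open>B\<close>, so it lies in
  \<open>A\<close>.\<close>

lemma twice_domination_number_le_total_Roman_domination_number:
  assumes "pair_graph G" "no_isolated_vertex G"
  shows "2 * domination_number G \<le> total_Roman_domination_number G"
proof -
  obtain f where f: "total_Roman_dominating_function G f"
    "(\<Sum>v\<in>pverts G. f v) = total_Roman_domination_number G"
    using minimum_total_Roman_dominating_function[OF assms] .
  have fin: "finite (pverts G)"
    using assms by (simp add: finite_pverts)
  let ?N = "neighbourhood G"
  define A where "A = {v\<in>pverts G. f v = 1}"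
  define B where "B = {v\<in>pverts G. f v = 2}"
  define W where "W = {v\<in>A. ?N v \<inter> B = {}}"
  have "finite A" "finite B" using fin by (simp_all add: A_def B_def)
  have vals: "f v = 0 \<or> v \<in> A \<or> v \<in> B" if "v \<in> pverts G" for v
    using f(1) that by (auto simp: total_Roman_dominating_function_def A_def B_def)
  have nbA: "\<exists>u\<in>A. u \<noteq> w \<and> u \<in> ?N w" if "w \<in> W" for w
  proof -
    have "w \<in> pverts G" using that by (simp add: W_def A_def)
    then obtain u where u: "u \<in> pverts G" "f u \<ge> 1" "u \<in> ?N w"
      using f(1) by (auto simp: total_Roman_dominating_function_def total_dominating_set_def)
    then have "u \<in> A" using vals[of u] that by (auto simp: W_def)
    then show ?thesis using u neighbourhood_irrefl[OF assms(1)] by metis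
  qed
  obtain X where X: "X \<subseteq> A" "2 * card X \<le> card A"
    "\<And>w. w \<in> W \<Longrightarrow> \<exists>u\<in>X. u = w \<or> u \<in> ?N w"
    by (rule half_size_dominating_subset[of A W "\<lambda>u w. u \<in> ?N w"])
      (use \<open>finite A\<close> nbA neighbourhood_sym[OF assms(1)] in \<open>auto simp: W_def\<close>)
  have "dominating_set G (B \<union> X)"
    unfolding dominating_set_def
  proof (intro conjI ballI)
    show "B \<union> X \<subseteq> pverts G" using X(1) by (auto simp: A_def B_def)
    fix v assume v: "v \<in> pverts G"
    have "\<exists>u\<in>B \<union> X. u = v \<or> u \<in> ?N v"
    proof (cases "f v = 0")
      case True
      then obtain w where "w \<in> ?N v" "f w = 2"
        using f(1) v by (auto simp: total_Roman_dominating_function_def)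
      then show ?thesis using neighbourhood_subset_pverts[OF assms(1)] by (auto simp: B_def)
    next
      case False
      then consider "v \<in> B" | "v \<in> W" | "?N v \<inter> B \<noteq> {}" using vals[OF v] by (auto simp: W_def)
      then show ?thesis using X(3) by cases blast+
    qed
    then show "\<exists>u\<in>B \<union> X. vertex_dominates G u v"
      using neighbourhood_sym[OF assms(1)] unfolding vertex_dominates_def by blast
  qed
  then have "domination_number G \<le> card (B \<union> X)" by (rule domination_number_le)
  also have "\<dots> \<le> card B + card X" by (rule card_Un_le)
  finally have "2 * domination_number G \<le> 2 * card B + card A" using X(2) by simp
  also have "\<dots> = (\<Sum>v\<in>B. f v) + (\<Sum>v\<in>A. f v)" by (simp add: A_def B_def)
  also have "\<dots> = (\<Sum>v\<in>B \<union> A. f v)"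
    using \<open>finite A\<close> \<open>finite B\<close> by (intro sum.union_disjoint[symmetric]) (auto simp: A_def B_def)
  also have "\<dots> \<le> (\<Sum>v\<in>pverts G. f v)"
    using fin by (intro sum_mono2) (auto simp: A_def B_def)
  finally show ?thesis using f(2) by simp
qed

section \<open>Discharging the fibre weights\<close>

text \<open>
  Call a fibre heavy if it carries a value 2. The base points \<open>A\<close> of the heavy fibres totally dominate
  \<open>G\<close> except for the set \<open>B\<close>. A fibre over \<open>B - A\<close> is constantly 1, so it pays for a neighbour of
  its base point, and so does a fibre over \<open>A \<inter> B\<close> of weight at least 4. As no vertex dominates \<open>H\<close>, any
  other fibre over \<open>A \<inter> B\<close> has weight 3 and a positive neighbouring fibre outside \<open>A \<union> B\<close>, which
  shares the cost of its own base point.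
\<close>
lemma total_Roman_domination_number_lexicographic_product_ge:
  assumes "pair_graph G" "no_isolated_vertex G" "pair_graph H" "card (pverts H) \<ge> 2"
    and "domination_number H \<ge> 2"
  shows "2 * total_domination_number G \<le> total_Roman_domination_number (lexicographic_product G H)"
proof -
  let ?P = "lexicographic_product G H" and ?V = "pverts G" and ?U = "pverts H"
  let ?N = "neighbourhood G" and ?M = "neighbourhood H"
  obtain f where f: "total_Roman_dominating_function ?P f"
    "(\<Sum>v\<in>pverts ?P. f v) = total_Roman_domination_number ?P"
    using minimum_total_Roman_dominating_function[OF
        pair_graph_lexicographic_product[OF assms(1,3)]
        no_isolated_vertex_lexicographic_product[OF assms(1,2)]] .
  have fin: "finite ?V" "finite ?U"
    using assms by (simp_all add: finite_pverts)
  define w where "w = (\<lambda>x. \<Sum>y\<in>?U. f (x, y))"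
  have sum_w: "(\<Sum>x\<in>?V. w x) = total_Roman_domination_number ?P"
    using f(2) by (simp add: w_def sum.cartesian_product)
  have w_ge: "(\<Sum>y\<in>Y. f (x, y)) \<le> w x" if "Y \<subseteq> ?U" for x Y
    unfolding w_def using fin that by (intro sum_mono2) auto
  have pos: "\<exists>u\<in>?V. \<exists>v\<in>?U. f (u, v) \<ge> 1 \<and> (u \<in> ?N x \<or> u = x \<and> v \<in> ?M y)"
    if "x \<in> ?V" "y \<in> ?U" for x y
  proof -
    have "\<exists>p\<in>{v\<in>pverts ?P. f v \<ge> 1}. p \<in> neighbourhood ?P (x, y)"
      using f(1) that
      unfolding total_Roman_dominating_function_def total_dominating_set_def by auto
    then show ?thesis using that by (auto simp: mem_neighbourhood_lexicographic_product)
  qed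
  have two: "\<exists>u\<in>?V. \<exists>v\<in>?U. f (u, v) = 2 \<and> (u \<in> ?N x \<or> u = x \<and> v \<in> ?M y)"
    if "x \<in> ?V" "y \<in> ?U" "f (x, y) = 0" for x y
  proof -
    have "\<exists>p\<in>neighbourhood ?P (x, y). f p = 2"
      using f(1) that unfolding total_Roman_dominating_function_def by auto
    then obtain u v where "(u, v) \<in> neighbourhood ?P (x, y)" "f (u, v) = 2"
      by (metis surj_pair)
    then show ?thesis using mem_neighbourhood_lexicographic_product[OF that(1,2)] by blast
  qed
  define A where "A = {x\<in>?V. \<exists>y\<in>?U. f (x, y) = 2}"
  define B where "B = {x\<in>?V. ?N x \<inter> A = {}}"
  define B3 where "B3 = {x\<in>A \<inter> B. w x < 4}"
  define B4 where "B4 = {x\<in>A \<inter> B. w x \<ge> 4}"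
  have wA: "w x \<ge> 2" if "x \<in> A" for x
  proof -
    obtain h where "h \<in> ?U" "f (x, h) = 2" using \<open>x \<in> A\<close> by (auto simp: A_def)
    then show ?thesis using w_ge[of "{h}" x] by simp
  qed
  have wBA: "w x \<ge> 2" if x: "x \<in> B - A" for x
  proof -
    \<comment> \<open>A 0 would need a 2 in the same fibre, contrary to \<open>x \<notin> A\<close>,
      or in a neighbouring one, contrary to \<open>x \<in> B\<close>.\<close>
    have "f (x, y) \<noteq> 0" if "y \<in> ?U" for y
      using two[of x y] x that by (auto simp: A_def B_def)
    then have "(\<Sum>y\<in>?U. 1) \<le> w x" unfolding w_def by (intro sum_mono) (simp add: Suc_le_eq)
    then show ?thesis using assms(4) by simp
  qed
  have B3: "w x \<ge> 3 \<and> (\<exists>u. u \<in> ?N x \<and> u \<in> ?V - (A \<union> B) \<and> w u \<ge> 1)" if x: "x \<in> B3" for x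
  proof -
    have xV: "x \<in> ?V" and xA: "x \<in> A" and xB: "?N x \<inter> A = {}" and w4: "w x < 4"
      using x by (auto simp: B3_def A_def B_def)
    obtain h where h: "h \<in> ?U" "f (x, h) = 2" using xA by (auto simp: A_def)
    have "\<not> dominating_set H {h}"
      using domination_number_le[of H "{h}"] assms(5) by auto
    then obtain k where k: "k \<in> ?U" "k \<noteq> h" "k \<notin> ?M h"
      using h(1) by (auto simp: dominating_set_def vertex_dominates_def)
    have hk: "l \<noteq> h" if "l \<in> ?M k" for l
      using that k(3) neighbourhood_sym[OF assms(3)] by blast
    \<comment> \<open>The 2 required by a 0 here would lie in the same fibre, since
      \<open>x \<in> B\<close>, and not at \<open>h\<close>: a second 2 brings the weight to
      4.\<close>
    have fk: "f (x, k) \<noteq> 0"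
    proof
      assume "f (x, k) = 0"
      then obtain u l where ul: "u \<in> ?V" "l \<in> ?U" "f (u, l) = 2" "u \<in> ?N x \<or> u = x \<and> l \<in> ?M k"
        using two[OF xV k(1)] by blast
      then have "u = x" "l \<in> ?M k" using xB by (auto simp: A_def)
      then show False using w_ge[of "{h, l}" x] hk[of l] h ul w4 by auto
    qed
    have "w x \<ge> 3" using w_ge[of "{h, k}" x] h k fk by auto
    moreover obtain u l where ul: "u \<in> ?V" "l \<in> ?U" "f (u, l) \<ge> 1"
        "u \<in> ?N x \<or> u = x \<and> l \<in> ?M k"
      using pos[OF xV k(1)] by blast
    \<comment> \<open>Otherwise the fibre is positive at \<open>h\<close>, \<open>k\<close> and a
      third vertex \<open>l\<close>, with total at least 2 + 1 + 1 = 4.\<close>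
    have u: "u \<in> ?N x"
    proof (rule ccontr)
      assume "u \<notin> ?N x"
      then have ux: "u = x" "l \<in> ?M k" using ul(4) by auto
      then have "l \<noteq> h" "l \<noteq> k" using hk neighbourhood_irrefl[OF assms(3)] by auto
      then show False using w_ge[of "{h, k, l}" x] h k fk ul ux(1) w4 by auto
    qed
    moreover have "u \<notin> A" using u xB by blast
    moreover have "u \<notin> B" using neighbourhood_sym[OF assms(1) u] xA by (auto simp: B_def)
    moreover have "w u \<ge> 1" using w_ge[of "{l}" u] ul by auto
    ultimately show ?thesis using ul(1) by blast
  qed
  then obtain g where g: "\<And>x. x \<in> B3 \<Longrightarrow> g x \<in> ?N x \<and> g x \<in> ?V - (A \<union> B) \<and> w (g x) \<ge> 1"
    by metis
  obtain n where n: "\<And>x. x \<in> ?V \<Longrightarrow> n x \<in> ?N x"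
    using assms(2) bchoice[of ?V "\<lambda>x u. u \<in> ?N x"] unfolding no_isolated_vertex_def by blast
  define C where "C = g ` B3"
  \<comment> \<open>Only \<open>B\<close> needs neighbours beyond \<open>A\<close>. Those chosen by
    \<open>n\<close> are arbitrary, as their cost is charged to \<open>B4\<close> and
    \<open>B - A\<close>; those chosen by \<open>g\<close> must carry weight themselves.\<close>
  define D where "D = A \<union> C \<union> n ` B4 \<union> n ` (B - A)"
  have sub: "A \<subseteq> ?V" "B \<subseteq> ?V" "B3 \<subseteq> ?V" "B4 \<subseteq> ?V" "C \<subseteq> ?V"
    using g by (auto simp: A_def B_def B3_def B4_def C_def)
  then have finS: "finite A" "finite B" "finite B3" "finite B4"
    using fin by (auto intro: finite_subset)
  have "total_dominating_set G D"
    unfolding total_dominating_set_def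
  proof (intro conjI ballI)
    show "D \<subseteq> ?V"
      using sub n neighbourhood_subset_pverts[OF assms(1)] by (force simp: D_def)
    fix x assume x: "x \<in> ?V"
    show "\<exists>u\<in>D. u \<in> ?N x"
    proof (cases "x \<in> B")
      case False
      then show ?thesis using x by (auto simp: B_def D_def)
    next
      case True
      then consider "x \<in> B3" | "x \<in> B4 \<union> (B - A)" by (force simp: B3_def B4_def)
      then show ?thesis
      proof cases
        case 1
        then show ?thesis using g[of x] by (auto simp: D_def C_def)
      next
        case 2
        then show ?thesis using n[OF x] by (auto simp: D_def)
      qed
    qed
  qed
  then have "total_domination_number G \<le> card D" by (rule total_domination_number_le)
  also have "card D \<le> card A + card C + card (n ` B4) + card (n ` (B - A))"
    unfolding D_def by (meson add_right_mono card_Un_le order_trans)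
  also have "\<dots> \<le> card A + card C + card B4 + card (B - A)"
    using finS by (intro add_mono card_image_le) auto
  finally have "2 * total_domination_number G
      \<le> 2 * card A + 2 * card (B - A) + 2 * card B4 + card C + card C"
    by simp
  \<comment> \<open>Of the two units that a vertex of \<open>C\<close> costs, it pays one itself and
    a preimage in \<open>B3\<close> pays the other; \<open>g\<close> need not be injective.\<close>
  also have "\<dots> \<le> 2 * card A + 2 * card (B - A) + 2 * card B4 + card B3 + card C"
    using card_image_le[OF finS(3), of g] by (simp add: C_def)
  also have "\<dots> = (\<Sum>x\<in>?V. 2 * of_bool (x \<in> A) + 2 * of_bool (x \<in> B - A)
      + 2 * of_bool (x \<in> B4) + of_bool (x \<in> B3) + of_bool (x \<in> C))"
  proof -
    have "(\<Sum>x\<in>?V. of_bool (x \<in> Y)) = card Y" if "Y \<subseteq> ?V" for Y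
      using fin that by (simp add: Int_absorb1)
    moreover have "B - A \<subseteq> ?V" using sub by blast
    ultimately show ?thesis
      using sub by (simp add: sum.distrib sum_distrib_left[symmetric]
          del: sum_of_bool_eq Diff_iff)
  qed
  also have "\<dots> \<le> (\<Sum>x\<in>?V. w x)"
  proof (rule sum_mono)
    \<comment> \<open>The charge is 3 on \<open>B3\<close>, 4 on \<open>B4\<close>, 2 on the rest of
      \<open>A\<close> and on \<open>B - A\<close>, and 1 on \<open>C\<close>, which is disjoint
      from \<open>A \<union> B\<close>.\<close>
    fix x assume "x \<in> ?V"
    have "x \<notin> A \<union> B" "w x \<ge> 1" if "x \<in> C" using that g by (auto simp: C_def)
    then show "2 * of_bool (x \<in> A) + 2 * of_bool (x \<in> B - A)
        + 2 * of_bool (x \<in> B4) + of_bool (x \<in> B3) + of_bool (x \<in> C) \<le> w x"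
      using wA[of x] wBA[of x] B3[of x]
      by (cases "x \<in> A"; cases "x \<in> B"; cases "x \<in> C"; cases "w x < 4")
        (auto simp: B3_def B4_def)
  qed
  finally show ?thesis using sum_w by simp
qed

section \<open>The equivalence\<close>

theorem theorem2p4:
  fixes G :: "'a pair_pre_digraph" and H :: "'b pair_pre_digraph"
  assumes "pair_graph G" and "pverts G \<noteq> {}" and "no_isolated_vertex G"
    and "pair_graph H" and "card (pverts H) \<ge> 2"
  shows "double_domination_number (lexicographic_product G H) = 2 * total_domination_number G
     \<longleftrightarrow>
       double_domination_number (lexicographic_product G H)
         = total_Roman_domination_number (lexicographic_product G H)
       \<and> (total_domination_number G = domination_number G \<or> domination_number H \<ge> 2)"
proof -
  let ?P = "lexicographic_product G H"
  have ne: "pverts H \<noteq> {}" using assms(5) by auto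
  have upper: "total_Roman_domination_number ?P \<le> 2 * total_domination_number G"
    by (rule total_Roman_domination_number_lexicographic_product_le[OF assms(1,3,4) ne])
  have "2 * domination_number G \<le> 2 * domination_number ?P"
    using domination_number_le_lexicographic_product[OF assms(1,4) ne] by simp
  also have "\<dots> \<le> total_Roman_domination_number ?P"
    by (rule twice_domination_number_le_total_Roman_domination_number[OF
          pair_graph_lexicographic_product[OF assms(1,4)]
          no_isolated_vertex_lexicographic_product[OF assms(1,3)]])
  finally have lower: "2 * domination_number G \<le> total_Roman_domination_number ?P" .
  have Roman: "total_Roman_domination_number ?P = 2 * total_domination_number G"
    if "total_domination_number G = domination_number G \<or> domination_number H \<ge> 2"
    using that upper lower
      total_Roman_domination_number_lexicographic_product_ge[OF assms(1,3,4,5)]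
    by auto
  have "total_domination_number G = domination_number G \<or> domination_number H \<ge> 2"
    if "double_domination_number ?P = 2 * total_domination_number G"
    using that double_domination_number_lexicographic_product_le[OF assms(1,3,4,5)]
      domination_number_le_total_domination_number[OF assms(1,3)]
    by linarith
  \<comment> \<open>Under the disjunction, \<open>Roman\<close> turns the equation in (b) into (a);
    the preceding fact derives the disjunction from (a).\<close>
  then show ?thesis using Roman by metis
qed

end
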